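(* Assume (A3), (A4), let $p=2$, $q\in(0,1)$, $\beta\ge q(1-q)$, and let $x$ be a bounded trajectory solution of (MTRIGS) with initial data $(x_0,v_0)$. Then for every $r\in[q,\frac{1+q}2]$, $$\int_{t_0}^{+\infty}s^{2r-q}\|\dot x(s)\|^2\,ds<+\infty .$$
   Context: $\mathcal H$ real Hilbert space; $f_1,\dots,f_m:\mathcal H\to\mathbb R$ convex, continuously differentiable with Lipschitz continuous gradients; $F=(f_1,\dots,f_m)^\top$. Weak Pareto optimal: no $x$ with $f_i(x)<f_i(x^* )$ for all $i$; $\mathcal P_w$ the set of such points. $\mathcal L(F,b):=\{x:f_i(x)\le b_i\ \forall i\}$, $\mathcal{LP}_w(F,b):=\mathcal L(F,b)\cap\mathcal P_w$. Parameters $t_0>0$, $\alpha,\beta>0$, $q\in(0,1]$, $p\in(0,2]$, initial data $x_0,v_0\in\mathcal H$; $C(x):=\operatorname{conv}\{\nabla f_i(x)\}$. A trajectory solution of (MTRIGS) is $x:[t_0,\infty)\to\mathcal H$, continuously differentiable, with $\dot x$ absolutely continuous on each $[t_0,T]$ and a.e. derivative $\ddot x$ (Bochner measurable, $\dot x(t)=\dot x(t_0)+\int_{t_0}^t\ddot x$), satisfying $\frac{\alpha}{t^q}\dot x(t)+\operatorname{proj}_{C(x(t))+\frac{\beta}{t^p}x(t)+\ddot x(t)}(0)=0$ for a.e. $t\ge t_0$, $x(t_0)=x_0$, $\dot x(t_0)=v_0$. (A3): with $a_i:=\frac{\beta}{2t_0^p}\|x_0\|^2+\frac12\|v_0\|^2$,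 for every $x\in\mathcal L(F,F(x_0)+a)$, $\mathcal{LP}_w(F,F(x))\ne\emptyset$, and $R:=\sup_{F^*\in F(\mathcal{LP}_w(F,F(x_0)+a))}\inf_{z\in F^{-1}(\{F^*\})}\|z\|<\infty$. (A4): $S(w):=\operatorname{argmin}_z\max_i(f_i(z)-w_i)\neq\emptyset$ for all $w\in\mathbb R^m$ and $w\mapsto\operatorname{proj}_{S(w)}(0)$ is continuous. *)

theory Defs
  imports "HOL-Analysis.Analysis"
begin

definition is_proj :: "'a::real_normed_vector set \<Rightarrow> 'a \<Rightarrow> 'a \<Rightarrow> bool" where
  "is_proj K y z \<longleftrightarrow> z \<in> K \<and> (\<forall>w\<in>K. dist y z \<le> dist y w)"

(* metric projection onto a nonempty closed convex set of a Hilbert space (unique there) *)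
definition proj :: "'a::real_normed_vector set \<Rightarrow> 'a \<Rightarrow> 'a" where
  "proj K y = (THE z. is_proj K y z)"

definition abs_continuous_on :: "real \<Rightarrow> real \<Rightarrow> (real \<Rightarrow> 'a::real_normed_vector) \<Rightarrow> bool" where
  "abs_continuous_on a b g \<longleftrightarrow>
     (\<forall>\<epsilon>>0. \<exists>\<delta>>0. \<forall>(n::nat) (u::nat \<Rightarrow> real) v.
        (\<forall>k<n. a \<le> u k \<and> u k \<le> v k \<and> v k \<le> b) \<and>
        (\<forall>k<n. \<forall>l<n. k \<noteq> l \<longrightarrow> v k \<le> u l \<or> v l \<le> u k) \<and>
        (\<Sum>k<n. v k - u k) < \<delta>
        \<longrightarrow> (\<Sum>k<n. norm (g (v k) - g (u k))) < \<epsilon>)"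

definition weak_pareto :: "('i \<Rightarrow> 'a \<Rightarrow> real) \<Rightarrow> 'a set" where
  "weak_pareto f = {xs. \<not> (\<exists>x. \<forall>i. f i x < f i xs)}"

definition level_set :: "('i \<Rightarrow> 'a \<Rightarrow> real) \<Rightarrow> ('i \<Rightarrow> real) \<Rightarrow> 'a set" where
  "level_set f b = {x. \<forall>i. f i x \<le> b i}"

definition LPw :: "('i \<Rightarrow> 'a \<Rightarrow> real) \<Rightarrow> ('i \<Rightarrow> real) \<Rightarrow> 'a set" where
  "LPw f b = level_set f b \<inter> weak_pareto f"

definition Fvec :: "('i \<Rightarrow> 'a \<Rightarrow> real) \<Rightarrow> 'a \<Rightarrow> ('i \<Rightarrow> real)" where
  "Fvec f x = (\<lambda>i. f i x)"

definition Sset :: "('i::finite \<Rightarrow> 'a \<Rightarrow> real) \<Rightarrow> ('i \<Rightarrow> real) \<Rightarrow> 'a set" where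
  "Sset f w = {z. \<forall>y. Max (range (\<lambda>i. f i z - w i)) \<le> Max (range (\<lambda>i. f i y - w i))}"

definition A3 :: "('i \<Rightarrow> 'a::real_normed_vector \<Rightarrow> real) \<Rightarrow> real \<Rightarrow> real \<Rightarrow> real \<Rightarrow> 'a \<Rightarrow> 'a \<Rightarrow> bool" where
  "A3 f \<beta> t0 p x0 v0 \<longleftrightarrow>
    (let a = \<beta> / (2 * t0 powr p) * (norm x0)\<^sup>2 + (norm v0)\<^sup>2 / 2;
         b = (\<lambda>i. f i x0 + a) in
     (\<forall>x \<in> level_set f b. LPw f (Fvec f x) \<noteq> {}) \<and>
     (\<exists>R::real. \<forall>Fs \<in> Fvec f ` LPw f b. (INF z\<in>{z. Fvec f z = Fs}. norm z) \<le> R))"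

definition A4 :: "('i::finite \<Rightarrow> 'a::real_normed_vector \<Rightarrow> real) \<Rightarrow> bool" where
  "A4 f \<longleftrightarrow> (\<forall>w. Sset f w \<noteq> {}) \<and> continuous_on UNIV (\<lambda>w. proj (Sset f w) 0)"

definition MTRIGS_solution ::
  "('i::finite \<Rightarrow> 'a::{real_inner,complete_space} \<Rightarrow> 'a) \<Rightarrow> real \<Rightarrow> real \<Rightarrow> real \<Rightarrow> real \<Rightarrow> real \<Rightarrow> 'a \<Rightarrow> 'a
   \<Rightarrow> (real \<Rightarrow> 'a) \<Rightarrow> (real \<Rightarrow> 'a) \<Rightarrow> (real \<Rightarrow> 'a) \<Rightarrow> bool" where
  "MTRIGS_solution g t0 \<alpha> \<beta> q p x0 v0 x x' x'' \<longleftrightarrow>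
     (\<forall>t\<ge>t0. (x has_vector_derivative x' t) (at t within {t0..})) \<and>
     continuous_on {t0..} x' \<and>
     (\<forall>T\<ge>t0. abs_continuous_on t0 T x') \<and>
     (AE t in lborel. t > t0 \<longrightarrow> (x' has_vector_derivative x'' t) (at t)) \<and>
     (\<forall>t\<ge>t0. (x'' has_integral (x' t - x' t0)) {t0..t}) \<and>
     (AE t in lborel. t \<ge> t0 \<longrightarrow>
        (\<alpha> / t powr q) *\<^sub>R x' t +
        proj ((\<lambda>c. c + (\<beta> / t powr p) *\<^sub>R x t + x'' t) ` (convex hull (range (\<lambda>i. g i (x t))))) 0 = 0) \<and>
     x t0 = x0 \<and> x' t0 = v0"

end

theory Submission
  imports Defs
begin

text \<open>
  Fix \<open>T\<close> and compare the trajectory with the point \<open>z = x T\<close>; all bounds are uniform in \<open>T\<close> because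
  \<open>x\<close> is bounded. Let \<open>m t\<close> be the minimum over \<open>i\<close> of \<open>f i (x t) - f i z\<close>, so that \<open>m T = 0\<close>.
  The variational inequality of the projection makes
  \<open>V t = m t + \<beta> / (2 t^2) |x t|^2 + |x' t|^2 / 2 + A t\<close> nonincreasing, where \<open>A\<close> is the integral of
  \<open>\<alpha> t^(-q) |x'|^2\<close>. Since the projection lies in the translated convex hull of the gradients, convexity
  bounds the derivative of \<open>t^q (x - z) \<bullet> x' + (\<alpha> - q t^(q-1)) |x - z|^2 / 2\<close> by
  \<open>t^q |x'|^2 - t^q m t\<close> up to a multiple of \<open>t^(q-2)\<close>, which is integrable as \<open>q < 1\<close>; this functional
  also vanishes at \<open>T\<close>, so the integral of \<open>t^q m t\<close> is controlled by that of \<open>t^q |x'|^2\<close>.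
  Integrating \<open>\<alpha> t |x'|^2 = t^(1+q) A' t\<close> by parts and inserting both estimates bounds the integral of
  \<open>t |x'|^2\<close> over \<open>{t0..T}\<close> by a constant plus a multiple of the integral of \<open>t^q |x'|^2\<close>, and the latter
  is absorbed because \<open>t^q\<close> is at most a small multiple of \<open>t\<close> plus a multiple of \<open>t^(-q)\<close>.
\<close>

section \<open>Absolutely continuous functions\<close>

definition nonoverlapping_intervals :: "real \<Rightarrow> real \<Rightarrow> nat \<Rightarrow> (nat \<Rightarrow> real) \<Rightarrow> (nat \<Rightarrow> real) \<Rightarrow> bool" where
  "nonoverlapping_intervals a b n u v \<longleftrightarrow>
     (\<forall>k<n. a \<le> u k \<and> u k \<le> v k \<and> v k \<le> b) \<and>
     (\<forall>k<n. \<forall>l<n. k \<noteq> l \<longrightarrow> v k \<le> u l \<or> v l \<le> u k)"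

lemma abs_continuous_on_iff:
  "abs_continuous_on a b g \<longleftrightarrow>
     (\<forall>\<epsilon>>0. \<exists>\<delta>>0. \<forall>n u v. nonoverlapping_intervals a b n u v \<and> (\<Sum>k<n. v k - u k) < \<delta>
        \<longrightarrow> (\<Sum>k<n. norm (g (v k) - g (u k))) < \<epsilon>)"
  unfolding abs_continuous_on_def nonoverlapping_intervals_def conj_assoc ..

text \<open>
  The exceptional null set is covered by an open set of small measure. In a tagged division that is
  fine for the resulting gauge, the intervals tagged in the null set have small total length and are
  controlled by absolute continuity, the others by the sign of the derivative at their tag.
\<close>

lemma abs_continuous_on_nonincreasing:
  fixes g :: "real \<Rightarrow> real"
  assumes ab: "a \<le> b" and ac: "abs_continuous_on a b g"
    and ae: "AE t in lborel. t \<in> {a<..<b} \<longrightarrow> (\<exists>d\<le>0. (g has_real_derivative d) (at t within {a..b}))"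
  shows "g b \<le> g a"
proof (rule field_le_epsilon)
  fix e :: real
  assume "e > 0"
  then obtain \<delta> where \<delta>: "\<delta> > 0" and ac\<delta>:
    "\<And>n u v. nonoverlapping_intervals a b n u v \<Longrightarrow> (\<Sum>k<n. v k - u k) < \<delta>
       \<Longrightarrow> (\<Sum>k<n. norm (g (v k) - g (u k))) < e / 2"
    using ac unfolding abs_continuous_on_iff by (meson half_gt_zero)
  \<comment> \<open>The slope tolerance \<open>c\<close> costs at most \<open>e / 2\<close> over the
    whole interval; the \<open>+ 1\<close> keeps the denominator positive when
    \<open>a = b\<close>.\<close>
  define c where "c = e / (2 * (b - a + 1))"
  have c: "c > 0" "c * (b - a) \<le> e / 2"
    using \<open>e > 0\<close> ab by (auto simp: c_def field_simps)
  obtain N0 where N0: "{t \<in> space lborel. \<not> (t \<in> {a<..<b} \<longrightarrow> (\<exists>d\<le>0. (g has_real_derivative d) (at t within {a..b})))} \<subseteq> N0"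
    "N0 \<in> null_sets lborel"
    using ae unfolding eventually_ae_filter by blast
  \<comment> \<open>The derivative condition covers only the open interval, so the endpoints join
    the exceptional set.\<close>
  define N where "N = N0 \<union> {a, b}"
  have N: "N \<in> null_sets lborel"
    unfolding N_def by (intro null_sets.Un N0(2) finite_imp_null_set_lborel) simp
  have "N \<in> sets borel"
    using N by (simp add: null_sets_def)
  then obtain U where U: "open U" "N \<subseteq> U" "emeasure lborel (U - N) < \<delta>"
    using \<delta> by (rule outer_regular_lborel)
  have emU: "emeasure lborel U < \<delta>"
    using U emeasure_Diff_null_set[OF N, of U] by simp
  \<comment> \<open>Multiplying by \<open>y - t\<close> treats both sides of \<open>t\<close> at
    once; the linear term \<open>d * (y - t)\<^sup>2\<close> has a favourable sign because
    \<open>d \<le> 0\<close>.\<close>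
  have "\<exists>r>0. \<forall>y\<in>{a..b}. \<bar>y - t\<bar> < r \<longrightarrow> (y - t) * (g y - g t) \<le> c * (y - t)\<^sup>2"
    if "t \<in> {a..b}" "t \<notin> N" for t
  proof -
    have "t \<in> {a<..<b}" "t \<notin> N0"
      using that by (auto simp: N_def less_le)
    then obtain d where d: "d \<le> 0" "(g has_real_derivative d) (at t within {a..b})"
      using N0(1) by auto
    then have "(g has_derivative (*) d) (at t within {a..b})"
      by (simp add: has_field_derivative_def)
    then have "\<exists>r>0. \<forall>y\<in>{a..b}. norm (y - t) < r \<longrightarrow> norm (g y - g t - d * (y - t)) \<le> c * norm (y - t)"
      using c(1) unfolding has_derivative_within_alt by simp
    then obtain r where r: "r > 0"
      "\<And>y. y \<in> {a..b} \<Longrightarrow> norm (y - t) < r \<Longrightarrow> norm (g y - g t - d * (y - t)) \<le> c * norm (y - t)"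
      by auto
    have "(y - t) * (g y - g t) \<le> c * (y - t)\<^sup>2" if "y \<in> {a..b}" "\<bar>y - t\<bar> < r" for y
    proof -
      have "(y - t) * (g y - g t - d * (y - t)) \<le> \<bar>y - t\<bar> * (c * \<bar>y - t\<bar>)"
      proof -
        have "(y - t) * (g y - g t - d * (y - t)) \<le> \<bar>y - t\<bar> * \<bar>g y - g t - d * (y - t)\<bar>"
          by (metis abs_ge_self abs_mult)
        also have "\<dots> \<le> \<bar>y - t\<bar> * (c * \<bar>y - t\<bar>)"
          using r(2)[OF that(1)] that(2) by (intro mult_left_mono) auto
        finally show ?thesis .
      qed
      moreover have "d * (y - t)\<^sup>2 \<le> 0"
        using d(1) by (simp add: mult_nonpos_nonneg)
      ultimately show ?thesis
        by (simp add: power2_eq_square algebra_simps)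
    qed
    with r(1) show ?thesis by blast
  qed
  then obtain \<rho> where \<rho>: "\<And>t. t \<in> {a..b} \<Longrightarrow> t \<notin> N \<Longrightarrow> \<rho> t > 0"
    "\<And>t y. t \<in> {a..b} \<Longrightarrow> t \<notin> N \<Longrightarrow> y \<in> {a..b} \<Longrightarrow> \<bar>y - t\<bar> < \<rho> t
       \<Longrightarrow> (y - t) * (g y - g t) \<le> c * (y - t)\<^sup>2"
    by metis
  \<comment> \<open>Tags in \<open>N\<close> get all of \<open>U\<close>, so their intervals lie in
    the small open set; tags outside \<open>{a..b}\<close> do not occur in the division and get a
    dummy ball.\<close>
  define \<gamma> where "\<gamma> t = (if t \<in> N then U else if t \<in> {a..b} then ball t (\<rho> t) else ball t 1)" for t
  have "gauge \<gamma>"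
    using U(1,2) \<rho>(1) by (auto simp: gauge_def \<gamma>_def)
  then obtain p where p: "p tagged_division_of {a..b}" "\<gamma> fine p"
    using fine_division_exists_real by blast
  have int: "\<exists>u v. K = {u..v} \<and> u \<le> t \<and> t \<le> v \<and> a \<le> u \<and> v \<le> b \<and> Inf K = u \<and> Sup K = v" if tK: "(t, K) \<in> p" for t K
  proof -
    obtain u v where "K = {u..v}"
      using p(1) tK by (metis box_real(2) tagged_division_ofD(4))
    moreover have "t \<in> K" "K \<subseteq> {a..b}"
      using p(1) tK by auto
    ultimately show ?thesis by auto
  qed
  define G where "G = (\<lambda>(t :: real, K). g (Sup K) - g (Inf K))"
  \<comment> \<open>Degenerate intervals are left out: they contribute nothing to \<open>G\<close>,
    and positive length lets disjoint interiors be read as an ordering of the endpoints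
    below.\<close>
  define bad where "bad = {(t, K) \<in> p. t \<in> N \<and> Inf K < Sup K}"
  have fin: "finite p" "bad \<subseteq> p" "finite bad"
    using p(1) by (auto simp: bad_def intro: finite_subset[of _ p])
  have good: "G (t, K) \<le> c * measure lborel K" if tK: "(t, K) \<in> p - bad" for t K
  proof -
    obtain u v where uv: "K = {u..v}" "u \<le> t" "t \<le> v" "a \<le> u" "v \<le> b" "Inf K = u" "Sup K = v"
      using int[OF DiffD1[OF tK]] by metis
    show ?thesis
    proof (cases "t \<in> N")
      case True
      with tK uv have "u = v" by (auto simp: bad_def)
      then show ?thesis using uv by (simp add: G_def)
    next
      case False
      have "K \<subseteq> ball t (\<rho> t)"
        using fineD[OF p(2) DiffD1[OF tK]] False uv by (simp add: \<gamma>_def)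
      moreover have "u \<in> K" "v \<in> K"
        using uv by auto
      ultimately have "\<bar>u - t\<bar> < \<rho> t" "\<bar>v - t\<bar> < \<rho> t"
        by (auto simp: dist_real_def abs_minus_commute)
      then have "(u - t) * (g u - g t) \<le> c * (u - t)\<^sup>2" "(v - t) * (g v - g t) \<le> c * (v - t)\<^sup>2"
        using \<rho>(2)[of t] False uv by auto
      then have "(t - u) * (g t - g u) \<le> (t - u) * (c * (t - u))" "(v - t) * (g v - g t) \<le> (v - t) * (c * (v - t))"
        by (auto simp: power2_eq_square algebra_simps)
      \<comment> \<open>If the tag is an endpoint of its interval, the corresponding inequality is
        \<open>0 \<le> 0\<close>; otherwise the positive factor cancels.\<close>
      then have "g t - g u \<le> c * (t - u)" "g v - g t \<le> c * (v - t)"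
        using uv by (cases "t = u"; cases "t = v"; simp add: mult_le_cancel_left)+
      then show ?thesis
        using uv by (simp add: G_def algebra_simps)
    qed
  qed
  have "sum G (p - bad) \<le> (\<Sum>(t, K)\<in>p - bad. c * measure lborel K)"
    using good by (intro sum_mono) auto
  also have "\<dots> \<le> (\<Sum>(t, K)\<in>p. c * measure lborel K)"
    using c(1) fin by (intro sum_mono2) auto
  also have "\<dots> = c * (b - a)"
    using additive_content_tagged_division[of p a b] p(1) ab
    by (simp add: sum_distrib_left[symmetric] case_prod_unfold)
  finally have good_sum: "sum G (p - bad) \<le> e / 2"
    using c(2) by simp

  obtain h where h: "bij_betw h {..<card bad} bad"
    using ex_bij_betw_nat_finite[OF fin(3)] by (auto simp: atLeast0LessThan)
  define u where "u k = Inf (snd (h k))" for k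
  define v where "v k = Sup (snd (h k))" for k
  have hk: "\<exists>t. h k = (t, {u k..v k}) \<and> (t, {u k..v k}) \<in> p \<and> t \<in> N \<and> u k < v k \<and> a \<le> u k \<and> v k \<le> b"
    if "k < card bad" for k
  proof -
    have "h k \<in> bad" using h that by (auto simp: bij_betw_def)
    then show ?thesis
      using int[of "fst (h k)" "snd (h k)"] unfolding bad_def u_def v_def
      by (cases "h k") auto
  qed
  have disj: "v k \<le> u l \<or> v l \<le> u k" if kl: "k < card bad" "l < card bad" "k \<noteq> l" for k l
  proof -
    obtain s t where st: "h k = (s, {u k..v k})" "h l = (t, {u l..v l})"
      "(s, {u k..v k}) \<in> p" "(t, {u l..v l}) \<in> p" "u k < v k" "u l < v l"
      using hk[OF kl(1)] hk[OF kl(2)] by blast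
    have "h k \<noteq> h l" using h kl by (auto simp: bij_betw_def inj_on_def)
    then have "interior {u k..v k} \<inter> interior {u l..v l} = {}"
      using tagged_division_ofD(5)[OF p(1) st(3,4)] st(1,2) by metis
    then have "{max (u k) (u l)<..<min (v k) (v l)} = {}"
      by (auto simp: interior_atLeastAtMost_real)
    then show ?thesis
      using st(5,6) by (auto simp: min_def max_def split: if_splits)
  qed
  \<comment> \<open>Closed intervals may touch, so their lengths are added through the disjoint open
    interiors, all contained in \<open>U\<close>.\<close>
  have "ennreal (\<Sum>k<card bad. v k - u k) = (\<Sum>k<card bad. emeasure lborel {u k<..<v k})"
    using hk by (subst sum_ennreal[symmetric]) (force intro!: sum.cong)+
  also have "\<dots> = emeasure lborel (\<Union>k<card bad. {u k<..<v k})"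
    using disj by (intro sum_emeasure) (fastforce simp: disjoint_family_on_def)+
  also have "\<dots> \<le> emeasure lborel U"
  proof (intro emeasure_mono UN_least)
    fix k assume "k \<in> {..<card bad}"
    then obtain t where "(t, {u k..v k}) \<in> p" "t \<in> N" using hk by blast
    then have "{u k..v k} \<subseteq> U"
      using fineD[OF p(2)] by (force simp: \<gamma>_def)
    then show "{u k<..<v k} \<subseteq> U"
      using greaterThanLessThan_subseteq_atLeastAtMost_iff by (force simp: subset_eq)
  qed (use U(1) in auto)
  also have "\<dots> < \<delta>" by (rule emU)
  finally have "(\<Sum>k<card bad. v k - u k) < \<delta>"
    by (metis ennreal_leI not_le)
  then have "(\<Sum>k<card bad. norm (g (v k) - g (u k))) < e / 2"
    using hk disj by (intro ac\<delta>) (auto simp: nonoverlapping_intervals_def intro: less_imp_le)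
  moreover have "sum G bad = (\<Sum>k<card bad. g (v k) - g (u k))"
    by (simp add: sum.reindex_bij_betw[OF h, symmetric] G_def u_def v_def case_prod_unfold)
  ultimately have "sum G bad \<le> e / 2"
    using sum_mono[of "{..<card bad}" "\<lambda>k. g (v k) - g (u k)" "\<lambda>k. norm (g (v k) - g (u k))"] abs_ge_self
    by fastforce
  moreover have "sum G p = g b - g a"
    unfolding G_def using additive_tagged_division_1[OF ab p(1), of g] by simp
  ultimately show "g b \<le> g a + e"
    using good_sum sum.subset_diff[OF fin(2,1), of G] by simp
qed

section \<open>Closure properties of absolute continuity\<close>

lemma abs_continuous_on_subinterval:
  assumes "abs_continuous_on a b g" "a \<le> c" "d \<le> b"
  shows "abs_continuous_on c d g"
proof -
  have "nonoverlapping_intervals a b n u v" if "nonoverlapping_intervals c d n u v" for n u v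
    using that assms(2,3) unfolding nonoverlapping_intervals_def by force
  then show ?thesis
    using assms(1) unfolding abs_continuous_on_iff by meson
qed

text \<open>Common source of the closure properties below: each of them reduces to a comparison of
  increments, and the sums of increments of \<open>y\<close> and \<open>w\<close> can be made small
  simultaneously.\<close>

lemma abs_continuous_on_dominated:
  assumes "abs_continuous_on a b y" "abs_continuous_on a b w"
    and dom: "\<And>u v. a \<le> u \<Longrightarrow> u \<le> v \<Longrightarrow> v \<le> b \<Longrightarrow>
      norm (g v - g u) \<le> C * (norm (y v - y u) + norm (w v - w u))"
  shows "abs_continuous_on a b g"
  unfolding abs_continuous_on_iff
proof (intro allI impI)
  fix e :: real assume "e > 0"
  \<comment> \<open>A positive majorant of \<open>C\<close>, so that division by it is legitimate
    whatever the sign of \<open>C\<close>.\<close>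
  define C' where "C' = \<bar>C\<bar> + 1"
  have C': "C' > 0" "C \<le> C'" by (auto simp: C'_def)
  have e': "e / (2 * C') > 0" using \<open>e > 0\<close> C' by simp
  obtain d1 where d1: "d1 > 0" "\<And>n u v. nonoverlapping_intervals a b n u v \<Longrightarrow> (\<Sum>k<n. v k - u k) < d1
       \<Longrightarrow> (\<Sum>k<n. norm (y (v k) - y (u k))) < e / (2 * C')"
    using assms(1) e' unfolding abs_continuous_on_iff by meson
  obtain d2 where d2: "d2 > 0" "\<And>n u v. nonoverlapping_intervals a b n u v \<Longrightarrow> (\<Sum>k<n. v k - u k) < d2
       \<Longrightarrow> (\<Sum>k<n. norm (w (v k) - w (u k))) < e / (2 * C')"
    using assms(2) e' unfolding abs_continuous_on_iff by meson
  show "\<exists>\<delta>>0. \<forall>n u v. nonoverlapping_intervals a b n u v \<and> (\<Sum>k<n. v k - u k) < \<delta> \<longrightarrow> (\<Sum>k<n. norm (g (v k) - g (u k))) < e"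
  proof (intro exI[of _ "min d1 d2"] conjI allI impI)
    fix n :: nat and u v :: "nat \<Rightarrow> real"
    assume H: "nonoverlapping_intervals a b n u v \<and> (\<Sum>k<n. v k - u k) < min d1 d2"
    have "norm (g (v k) - g (u k)) \<le> C' * (norm (y (v k) - y (u k)) + norm (w (v k) - w (u k)))"
      if "k < n" for k
      using that H by (intro order_trans[OF dom] mult_right_mono C') (auto simp: nonoverlapping_intervals_def)
    then have "(\<Sum>k<n. norm (g (v k) - g (u k)))
        \<le> (\<Sum>k<n. C' * (norm (y (v k) - y (u k)) + norm (w (v k) - w (u k))))"
      by (intro sum_mono) auto
    also have "\<dots> = C' * ((\<Sum>k<n. norm (y (v k) - y (u k))) + (\<Sum>k<n. norm (w (v k) - w (u k))))"
      by (simp only: sum.distrib sum_distrib_left[symmetric])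
    also have "\<dots> < C' * (e / (2 * C') + e / (2 * C'))"
      using H by (intro mult_strict_left_mono add_strict_mono C' d1(2) d2(2)) auto
    finally show "(\<Sum>k<n. norm (g (v k) - g (u k))) < e"
      using C' by simp
  qed (use d1 d2 in auto)
qed

lemma abs_continuous_on_ident: "abs_continuous_on a b (\<lambda>t. t)"
  unfolding abs_continuous_on_iff
proof (intro allI impI)
  fix e :: real assume "e > 0"
  then show "\<exists>\<delta>>0. \<forall>n u v. nonoverlapping_intervals a b n u v \<and> (\<Sum>k<n. v k - u k) < \<delta> \<longrightarrow> (\<Sum>k<n. norm (v k - u k)) < e"
    by (intro exI[of _ e]) (auto simp: nonoverlapping_intervals_def)
qed

lemma abs_continuous_on_const: "abs_continuous_on a b (\<lambda>t. c)"
  by (rule abs_continuous_on_dominated[OF abs_continuous_on_ident abs_continuous_on_ident, of _ _ _ 0]) simp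

lemma abs_continuous_on_add:
  assumes "abs_continuous_on a b y" "abs_continuous_on a b w"
  shows "abs_continuous_on a b (\<lambda>t. y t + w t)"
  by (rule abs_continuous_on_dominated[OF assms, of _ 1])
    (simp add: add_diff_add norm_triangle_ineq)

text \<open>Both factors are bounded on the compact interval, and the increment of the product
  splits into increments of the factors weighted by these bounds.\<close>

lemma abs_continuous_on_inner:
  fixes y w :: "real \<Rightarrow> 'a::real_inner"
  assumes ac: "abs_continuous_on a b y" "abs_continuous_on a b w"
    and cont: "continuous_on {a..b} y" "continuous_on {a..b} w"
  shows "abs_continuous_on a b (\<lambda>t. y t \<bullet> w t)"
proof -
  obtain B1 B2 where B: "\<And>t. t \<in> {a..b} \<Longrightarrow> norm (y t) \<le> B1" "\<And>t. t \<in> {a..b} \<Longrightarrow> norm (w t) \<le> B2"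
    using compact_continuous_image[OF cont(1)] compact_continuous_image[OF cont(2)]
    by (metis bounded_iff compact_Icc compact_imp_bounded imageI)
  show ?thesis
  proof (rule abs_continuous_on_dominated[OF ac, of _ "max B1 B2"])
    fix u v assume uv: "a \<le> u" "u \<le> v" "v \<le> b"
    have "norm (y v \<bullet> w v - y u \<bullet> w u) = norm (y v \<bullet> (w v - w u) + (y v - y u) \<bullet> w u)"
      by (simp add: inner_diff_left inner_diff_right)
    also have "\<dots> \<le> norm (y v) * norm (w v - w u) + norm (y v - y u) * norm (w u)"
      by (intro order_trans[OF norm_triangle_ineq] add_mono) (auto simp: Cauchy_Schwarz_ineq2)
    also have "\<dots> \<le> max B1 B2 * norm (w v - w u) + norm (y v - y u) * max B1 B2"
      using uv B by (intro add_mono mult_right_mono mult_left_mono) (auto simp: le_max_iff_disj)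
    finally show "norm (y v \<bullet> w v - y u \<bullet> w u) \<le> max B1 B2 * (norm (y v - y u) + norm (w v - w u))"
      by (simp add: algebra_simps)
  qed
qed

lemma abs_continuous_on_mult:
  fixes y w :: "real \<Rightarrow> real"
  assumes "abs_continuous_on a b y" "abs_continuous_on a b w"
    and "continuous_on {a..b} y" "continuous_on {a..b} w"
  shows "abs_continuous_on a b (\<lambda>t. y t * w t)"
  using abs_continuous_on_inner[OF assms] by simp

text \<open>A bound for the continuous derivative makes \<open>y\<close> Lipschitz by the mean value
  inequality, hence dominated by the identity.\<close>

lemma C1_imp_abs_continuous_on:
  fixes y :: "real \<Rightarrow> 'a::real_normed_vector"
  assumes d: "\<And>t. t \<in> {a..b} \<Longrightarrow> (y has_vector_derivative y' t) (at t within {a..b})"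
    and cont: "continuous_on {a..b} y'"
  shows "abs_continuous_on a b y"
proof -
  obtain B where B: "\<And>t. t \<in> {a..b} \<Longrightarrow> norm (y' t) \<le> B"
    using compact_continuous_image[OF cont] by (metis bounded_iff compact_Icc compact_imp_bounded imageI)
  show ?thesis
  proof (rule abs_continuous_on_dominated[OF abs_continuous_on_ident abs_continuous_on_ident, of _ _ _ B])
    fix u v assume uv: "a \<le> u" "u \<le> v" "v \<le> b"
    have "onorm (\<lambda>h. h *\<^sub>R y' t) \<le> B" if "t \<in> {a..b}" for t
    proof (rule onorm_le)
      show "norm (h *\<^sub>R y' t) \<le> B * norm h" for h
        using mult_left_mono[OF B[OF that], of "\<bar>h\<bar>"] by (simp add: mult.commute)
    qed
    then have "norm (y v - y u) \<le> B * norm (v - u)"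
      using uv d unfolding has_vector_derivative_def
      by (intro differentiable_bound[of "{a..b}" y "\<lambda>t h. h *\<^sub>R y' t"]) auto
    moreover have "0 \<le> B" using order_trans[OF norm_ge_zero B[of u]] uv by simp
    ultimately show "norm (y v - y u) \<le> B * (norm (v - u) + norm (v - u))"
      by (smt (verit) mult_left_mono norm_ge_zero)
  qed
qed

section \<open>Convexity, projections and integrals\<close>

lemma has_real_derivative_inner:
  fixes u v :: "real \<Rightarrow> 'a::real_inner"
  assumes "(u has_vector_derivative u') (at t within S)" "(v has_vector_derivative v') (at t within S)"
  shows "((\<lambda>t. u t \<bullet> v t) has_real_derivative (u t \<bullet> v' + u' \<bullet> v t)) (at t within S)"
  using bounded_bilinear.has_vector_derivative[OF bounded_bilinear_inner assms]
  by (simp add: has_real_derivative_iff_has_vector_derivative)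

text \<open>Restriction to the line through \<open>y\<close> and \<open>z\<close> reduces this to
  the tangent inequality for a convex function of one real variable.\<close>

lemma convex_on_above_gradient:
  fixes f :: "'a::real_inner \<Rightarrow> real"
  assumes conv: "convex_on UNIV f" and grad: "(f has_derivative (\<lambda>h. G \<bullet> h)) (at y)"
  shows "f y + G \<bullet> (z - y) \<le> f z"
proof -
  let ?\<phi> = "\<lambda>s::real. f (y + s *\<^sub>R (z - y))"
  have "convex_on UNIV ?\<phi>"
  proof (rule convex_onI)
    fix t a b :: real assume "0 < t" "t < 1"
    have "y + ((1 - t) *\<^sub>R a + t *\<^sub>R b) *\<^sub>R (z - y)
        = (1 - t) *\<^sub>R (y + a *\<^sub>R (z - y)) + t *\<^sub>R (y + b *\<^sub>R (z - y))"
      by (simp add: algebra_simps)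
    then show "?\<phi> ((1 - t) *\<^sub>R a + t *\<^sub>R b) \<le> (1 - t) * ?\<phi> a + t * ?\<phi> b"
      using convex_onD[OF conv, of t] \<open>0 < t\<close> \<open>t < 1\<close> by simp
  qed simp
  moreover have "(?\<phi> has_real_derivative G \<bullet> (z - y)) (at 0)"
  proof -
    have "((\<lambda>s::real. y + s *\<^sub>R (z - y)) has_derivative (\<lambda>s. s *\<^sub>R (z - y))) (at 0)"
      by (auto intro!: derivative_eq_intros)
    moreover have "(f has_derivative (\<lambda>h. G \<bullet> h)) (at (y + 0 *\<^sub>R (z - y)))"
      using grad by simp
    ultimately have "(?\<phi> has_derivative (\<lambda>s. G \<bullet> (s *\<^sub>R (z - y)))) (at 0)"
      by (rule has_derivative_compose)
    then show ?thesis
      by (simp add: has_field_derivative_def mult_commute_abs)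
  qed
  ultimately have "?\<phi> 1 - ?\<phi> 0 \<ge> G \<bullet> (z - y) * (1 - 0)"
    by (intro convex_on_imp_above_tangent[of UNIV]) auto
  then show ?thesis by simp
qed

text \<open>Justifies the definite description in \<open>proj\<close>: compactness gives a nearest
  point, convexity its uniqueness. The convex hulls of finitely many gradients are of this
  kind.\<close>

lemma is_proj_proj_compact:
  fixes K :: "'a::real_inner set"
  assumes "convex K" "compact K" "K \<noteq> {}"
  shows "is_proj K a (proj K a)"
  unfolding proj_def
proof (rule theI')
  obtain z where "z \<in> K" "\<forall>w\<in>K. dist a z \<le> dist a w"
    using continuous_attains_inf[OF assms(2,3) continuous_on_dist[OF continuous_on_const continuous_on_id], of a]
    by auto
  then show "\<exists>!z. is_proj K a z"
    using any_closest_point_unique[OF assms(1) compact_imp_closed[OF assms(2)], of _ _ a]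
    by (intro ex1I[of _ z]) (auto simp: is_proj_def)
qed

lemma continuous_on_Min_image:
  fixes F :: "'i \<Rightarrow> 'b::topological_space \<Rightarrow> 'c::linorder_topology"
  assumes "finite I" "I \<noteq> {}" "\<And>i. i \<in> I \<Longrightarrow> continuous_on S (F i)"
  shows "continuous_on S (\<lambda>t. Min ((\<lambda>i. F i t) ` I))"
  using assms
proof (induction I rule: finite_ne_induct)
  case (insert i I)
  then have "continuous_on S (\<lambda>t. min (F i t) (Min ((\<lambda>i. F i t) ` I)))"
    by (intro continuous_on_min) auto
  then show ?case using insert.hyps by simp
qed simp

text \<open>Monotone convergence along the truncations to \<open>{a..a + real k}\<close> gives a
  gauge integral, which is absolute because \<open>f\<close> is nonnegative.\<close>

lemma set_integrable_atLeast_if_integrals_bounded: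
  fixes f :: "real \<Rightarrow> real"
  assumes cont: "continuous_on {a..} f" and nonneg: "\<And>t. t \<ge> a \<Longrightarrow> 0 \<le> f t"
    and bound: "\<And>T. T \<ge> a \<Longrightarrow> integral {a..T} f \<le> C"
  shows "set_integrable lborel {a..} f"
proof -
  let ?F = "\<lambda>k t. if t \<in> {a..a + real k} then f t else 0"
  have int: "f integrable_on {a..a + real k}" for k
    by (intro integrable_continuous_real continuous_on_subset[OF cont]) auto
  have Fint: "?F k integrable_on {a..}" for k
    using int[of k] by (subst integrable_restrict_Int) (simp add: Int_absorb2)
  have Fval: "integral {a..} (?F k) = integral {a..a + real k} f" for k
    by (subst integral_restrict_Int) (simp add: Int_absorb2)
  have "f integrable_on {a..} \<and> (\<lambda>k. integral {a..} (?F k)) \<longlonglongrightarrow> integral {a..} f"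
  proof (rule monotone_convergence_increasing[OF Fint])
    show "?F k t \<le> ?F (Suc k) t" if "t \<in> {a..}" for k t
      using that nonneg[of t] by auto
    show "(\<lambda>k. ?F k t) \<longlonglongrightarrow> f t" if "t \<in> {a..}" for t
    proof (rule tendsto_eventually)
      obtain n where "t - a \<le> real n" using real_arch_simple by blast
      then show "\<forall>\<^sub>F k in sequentially. ?F k t = f t"
        using that by (intro eventually_sequentiallyI[of n]) auto
    qed
    have "0 \<le> integral {a..a + real k} f" for k
      using nonneg by (intro integral_nonneg int) auto
    then show "bounded (range (\<lambda>k. integral {a..} (?F k)))"
      unfolding Fval using bound by (intro boundedI[of _ C]) auto
  qed
  then have "f absolutely_integrable_on {a..}"
    using nonneg by (intro nonnegative_absolutely_integrable_1) auto
  \<comment> \<open>Absolute integrability refers to the completed measure; Borel measurability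
    brings it back to \<open>lborel\<close>.\<close>
  moreover have "(\<lambda>t. indicator {a..} t *\<^sub>R f t) \<in> borel_measurable borel"
    using cont by (intro borel_measurable_continuous_on_indicator) auto
  ultimately show ?thesis
    unfolding set_integrable_def by (simp add: integrable_completion)
qed

section \<open>Energy estimates along a bounded trajectory\<close>

locale bounded_trajectory =
  fixes f :: "'i::finite \<Rightarrow> 'a::{real_inner,complete_space} \<Rightarrow> real"
    and g :: "'i \<Rightarrow> 'a \<Rightarrow> 'a"
    and t0 \<alpha> \<beta> q B :: real
    and x0 v0 :: 'a
    and x x' x'' :: "real \<Rightarrow> 'a"
  assumes conv: "\<And>i. convex_on UNIV (f i)"
    and grad: "\<And>i y. (f i has_derivative (\<lambda>h. g i y \<bullet> h)) (at y)"
    and cont_g: "\<And>i. continuous_on UNIV (g i)"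
    and t0_pos: "t0 > 0" and alpha_pos: "\<alpha> > 0" and beta_pos: "\<beta> > 0"
    and q_range: "0 < q" "q < 1"
    and sol: "MTRIGS_solution g t0 \<alpha> \<beta> q 2 x0 v0 x x' x''"
    and x_bound: "\<And>t. t \<ge> t0 \<Longrightarrow> norm (x t) \<le> B"
begin

section \<open>Regularity of the trajectory and the variational inequality\<close>

lemma solution_facts:
  shows x_deriv_atLeast: "\<forall>t\<ge>t0. (x has_vector_derivative x' t) (at t within {t0..})"
    and cont_x'_atLeast: "continuous_on {t0..} x'"
    and ac_x'_Icc: "\<forall>T\<ge>t0. abs_continuous_on t0 T x'"
    and AE_accel: "AE t in lborel. t > t0 \<longrightarrow> (x' has_vector_derivative x'' t) (at t)"
    and AE_proj: "AE t in lborel. t \<ge> t0 \<longrightarrow> (\<alpha> / t powr q) *\<^sub>R x' t +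
        proj ((\<lambda>c. c + (\<beta> / t powr 2) *\<^sub>R x t + x'' t) ` (convex hull (range (\<lambda>i. g i (x t))))) 0 = 0"
  using sol unfolding MTRIGS_solution_def by - (elim conjE, assumption)+

lemma x_deriv: "(x has_vector_derivative x' t) (at t within {a..b})" if "t0 \<le> a" "t \<in> {a..b}"
  by (rule has_vector_derivative_within_subset[OF x_deriv_atLeast[rule_format]]) (use that in auto)

lemma cont_x': "continuous_on {a..b} x'" if "t0 \<le> a"
  by (rule continuous_on_subset[OF cont_x'_atLeast]) (use that in auto)

lemma cont_x: "continuous_on {a..b} x" if "t0 \<le> a"
  using x_deriv[OF that] by (rule continuous_on_vector_derivative)

lemma f_deriv:
  assumes "t0 \<le> a" "t \<in> {a..b}"
  shows "((\<lambda>s. f i (x s)) has_real_derivative g i (x t) \<bullet> x' t) (at t within {a..b})"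
  using has_derivative_compose[OF x_deriv[OF assms, unfolded has_vector_derivative_def] grad]
  by (simp add: has_field_derivative_def mult_commute_abs)

lemma cont_f: "continuous_on {a..b} (\<lambda>s. f i (x s))" if "t0 \<le> a"
  using f_deriv[OF that] by (rule DERIV_continuous_on)

text \<open>The projection of \<open>0\<close> onto the translated hull is
  \<open>- (\<alpha> / t powr q) *\<^sub>R x' t\<close>. The obtuse-angle property against each
  translated gradient, divided by the positive factor, gives the first half; membership of the
  projection in the set gives the second.\<close>

lemma projection_inequalities:
  "AE t in lborel. t \<ge> t0 \<longrightarrow>
     (\<forall>i. (g i (x t) + (\<beta> / t powr 2) *\<^sub>R x t + x'' t + (\<alpha> / t powr q) *\<^sub>R x' t) \<bullet> x' t \<le> 0) \<and>
     - ((\<beta> / t powr 2) *\<^sub>R x t + x'' t + (\<alpha> / t powr q) *\<^sub>R x' t) \<in> convex hull (range (\<lambda>i. g i (x t)))"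
  using AE_proj
proof (rule AE_mp, intro AE_I2 impI)
  fix t assume t: "t \<ge> t0"
  define H where "H = convex hull (range (\<lambda>i. g i (x t)))"
  define w where "w = (\<beta> / t powr 2) *\<^sub>R x t + x'' t"
  define K where "K = (\<lambda>c. w + c) ` H"
  define l where "l = \<alpha> / t powr q"
  have K_eq: "K = (\<lambda>c. c + (\<beta> / t powr 2) *\<^sub>R x t + x'' t) ` (convex hull (range (\<lambda>i. g i (x t))))"
    by (auto simp: K_def w_def H_def algebra_simps)
  assume "t \<ge> t0 \<longrightarrow> (\<alpha> / t powr q) *\<^sub>R x' t +
      proj ((\<lambda>c. c + (\<beta> / t powr 2) *\<^sub>R x t + x'' t) ` (convex hull (range (\<lambda>i. g i (x t))))) 0 = 0"
  then have proj_eq: "proj K 0 = - (l *\<^sub>R x' t)"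
    using t by (simp add: K_eq l_def add_eq_0_iff)
  have "compact H" "H \<noteq> {}" "convex H"
    unfolding H_def by (auto intro: finite_imp_compact_convex_hull)
  then have K: "convex K" "compact K" "K \<noteq> {}"
    unfolding K_def by (auto intro: compact_translation convex_translation)
  have "is_proj K 0 (- (l *\<^sub>R x' t))"
    using is_proj_proj_compact[OF K, of 0] by (simp add: proj_eq)
  then have u: "- (l *\<^sub>R x' t) \<in> K" "\<forall>y\<in>K. dist 0 (- (l *\<^sub>R x' t)) \<le> dist 0 y"
    by (auto simp: is_proj_def)
  have "l > 0"
    using alpha_pos t t0_pos by (simp add: l_def)
  have "(g i (x t) + w + l *\<^sub>R x' t) \<bullet> x' t \<le> 0" for i
  proof -
    have "w + g i (x t) \<in> K"
      unfolding K_def H_def by (intro imageI hull_inc) auto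
    from any_closest_point_dot[OF K(1) compact_imp_closed[OF K(2)] u(1) this u(2)]
    have "l * ((g i (x t) + w + l *\<^sub>R x' t) \<bullet> x' t) \<le> 0"
      by (simp add: inner_commute algebra_simps)
    with \<open>l > 0\<close> show ?thesis by (simp add: mult_le_0_iff)
  qed
  moreover have "- (w + l *\<^sub>R x' t) \<in> H"
  proof -
    obtain c where c: "c \<in> H" "- (l *\<^sub>R x' t) = w + c" using u(1) unfolding K_def by blast
    have "- (w + l *\<^sub>R x' t) = - (l *\<^sub>R x' t) - w" by simp
    also have "\<dots> = c" unfolding c(2) by simp
    finally show ?thesis using c(1) by simp
  qed
  ultimately show "(\<forall>i. (g i (x t) + (\<beta> / t powr 2) *\<^sub>R x t + x'' t + (\<alpha> / t powr q) *\<^sub>R x' t) \<bullet> x' t \<le> 0) \<and>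
   - ((\<beta> / t powr 2) *\<^sub>R x t + x'' t + (\<alpha> / t powr q) *\<^sub>R x' t) \<in> convex hull (range (\<lambda>i. g i (x t)))"
    by (simp add: w_def l_def H_def add.assoc)
qed

lemma ac_x': "abs_continuous_on a b x'" if "t0 \<le> a"
  by (rule abs_continuous_on_subinterval[OF ac_x'_Icc[rule_format, OF max.cobounded1[of t0 b]]]) (use that in auto)

section \<open>Dissipation of the component energies\<close>

definition dissipated :: "real \<Rightarrow> real" where
  "dissipated t = integral {t0..t} (\<lambda>s. \<alpha> * s powr (-q) * (x' s \<bullet> x' s))"

text \<open>One energy per objective has an explicit derivative almost everywhere; the minimum over
  \<open>i\<close> is taken only after monotonicity is known.\<close>

definition energy :: "'i \<Rightarrow> real \<Rightarrow> real" where
  "energy i t = f i (x t) + \<beta> / 2 * t powr (-2) * (x t \<bullet> x t) + 1 / 2 * (x' t \<bullet> x' t)"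

lemma dissipated_deriv:
  assumes "t0 \<le> a" "t \<in> {a..b}"
  shows "(dissipated has_real_derivative \<alpha> * t powr (-q) * (x' t \<bullet> x' t)) (at t within {a..b})"
proof -
  have "(dissipated has_real_derivative \<alpha> * t powr (-q) * (x' t \<bullet> x' t)) (at t within {t0..b})"
    unfolding dissipated_def using assms t0_pos
    by (intro integral_has_real_derivative continuous_intros cont_x') auto
  then show ?thesis using assms by (auto intro: DERIV_subset)
qed

lemma cont_dissipated: "continuous_on {a..b} dissipated" if "t0 \<le> a"
  using dissipated_deriv[OF that] by (rule DERIV_continuous_on)

text \<open>Almost everywhere the derivative is the first expression of
  \<open>projection_inequalities\<close> plus the contribution of the decaying factor
  \<open>t powr (-2)\<close>, both nonpositive; absolute continuity turns this into
  monotonicity.\<close>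

lemma energy_dissipation:
  assumes st: "t0 \<le> s" "s \<le> t"
  shows "energy i t + dissipated t \<le> energy i s + dissipated s"
proof -
  \<comment> \<open>The continuously differentiable terms are gathered in \<open>?c\<close>; only
    the kinetic term involves the almost everywhere acceleration.\<close>
  let ?c = "\<lambda>t. f i (x t) + \<beta> / 2 * t powr (-2) * (x t \<bullet> x t) + dissipated t"
  let ?c' = "\<lambda>t. g i (x t) \<bullet> x' t +
    (\<beta> / 2 * t powr (-2) * (x t \<bullet> x' t + x' t \<bullet> x t) + \<beta> / 2 * (- 2 * t powr (- 3)) * (x t \<bullet> x t)) +
    \<alpha> * t powr (-q) * (x' t \<bullet> x' t)"
  have c_deriv: "(?c has_real_derivative ?c' \<tau>) (at \<tau> within {s..t})" if "\<tau> \<in> {s..t}" for \<tau>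
  proof -
    have "\<tau> > 0" using that st t0_pos by simp
    then have "((\<lambda>t. \<beta> / 2 * t powr (-2)) has_real_derivative \<beta> / 2 * (- 2 * \<tau> powr (- 3))) (at \<tau> within {s..t})"
      by (auto intro!: derivative_eq_intros)
    from DERIV_mult'[OF this has_real_derivative_inner[OF x_deriv[OF st(1) that] x_deriv[OF st(1) that]]]
    show ?thesis
      by (intro DERIV_add f_deriv[OF st(1) that] dissipated_deriv[OF st(1) that])
  qed
  have ac_c: "abs_continuous_on s t ?c"
  proof (rule C1_imp_abs_continuous_on)
    show "(?c has_vector_derivative ?c' \<tau>) (at \<tau> within {s..t})" if "\<tau> \<in> {s..t}" for \<tau>
      using c_deriv[OF that] by (simp only: has_real_derivative_iff_has_vector_derivative)
    show "continuous_on {s..t} ?c'"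
      using st t0_pos
      by (intro continuous_intros cont_x[OF st(1)] cont_x'[OF st(1)] continuous_on_compose2[OF cont_g]) auto
  qed
  have ac_v: "abs_continuous_on s t (\<lambda>t. x' t \<bullet> x' t)"
    by (intro abs_continuous_on_inner ac_x'[OF st(1)] cont_x'[OF st(1)])
  have ac: "abs_continuous_on s t (\<lambda>t. 1 / 2 * (x' t \<bullet> x' t) + ?c t)"
    by (intro abs_continuous_on_add[OF _ ac_c] abs_continuous_on_mult[OF abs_continuous_on_const ac_v]
        continuous_on_const continuous_on_inner cont_x'[OF st(1)])
  have "1 / 2 * (x' t \<bullet> x' t) + ?c t \<le> 1 / 2 * (x' s \<bullet> x' s) + ?c s"
  proof (rule abs_continuous_on_nonincreasing[OF st(2) ac])
    show "AE \<tau> in lborel. \<tau> \<in> {s<..<t} \<longrightarrow>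
      (\<exists>d\<le>0. ((\<lambda>t. 1 / 2 * (x' t \<bullet> x' t) + ?c t) has_real_derivative d) (at \<tau> within {s..t}))"
      using AE_accel projection_inequalities
    proof (eventually_elim, intro impI)
      fix \<tau> assume \<tau>: "\<tau> \<in> {s<..<t}"
        and acc: "\<tau> > t0 \<longrightarrow> (x' has_vector_derivative x'' \<tau>) (at \<tau>)"
        and pr: "t0 \<le> \<tau> \<longrightarrow>
         (\<forall>i. (g i (x \<tau>) + (\<beta> / \<tau> powr 2) *\<^sub>R x \<tau> + x'' \<tau> + (\<alpha> / \<tau> powr q) *\<^sub>R x' \<tau>) \<bullet> x' \<tau> \<le> 0) \<and>
         - ((\<beta> / \<tau> powr 2) *\<^sub>R x \<tau> + x'' \<tau> + (\<alpha> / \<tau> powr q) *\<^sub>R x' \<tau>) \<in> convex hull range (\<lambda>i. g i (x \<tau>))"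
      have \<tau>0: "\<tau> > t0" "\<tau> > 0" "\<tau> \<in> {s..t}" using \<tau> st t0_pos by auto
      have "(x' has_vector_derivative x'' \<tau>) (at \<tau> within {s..t})"
        using acc \<tau>0 by (auto intro: has_vector_derivative_at_within)
      note DERIV_add[OF DERIV_cmult[OF has_real_derivative_inner[OF this this], of "1 / 2"] c_deriv[OF \<tau>0(3)]]
      moreover have "1 / 2 * (x' \<tau> \<bullet> x'' \<tau> + x'' \<tau> \<bullet> x' \<tau>) + ?c' \<tau> \<le> 0"
      proof -
        have "(g i (x \<tau>) + (\<beta> / \<tau> powr 2) *\<^sub>R x \<tau> + x'' \<tau> + (\<alpha> / \<tau> powr q) *\<^sub>R x' \<tau>) \<bullet> x' \<tau> \<le> 0"
          using pr \<tau>0 by simp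
        moreover have "1 / 2 * (x' \<tau> \<bullet> x'' \<tau> + x'' \<tau> \<bullet> x' \<tau>) + ?c' \<tau>
          = (g i (x \<tau>) + (\<beta> / \<tau> powr 2) *\<^sub>R x \<tau> + x'' \<tau> + (\<alpha> / \<tau> powr q) *\<^sub>R x' \<tau>) \<bullet> x' \<tau>
            - \<beta> * \<tau> powr (-3) * (x \<tau> \<bullet> x \<tau>)"
          by (simp add: inner_add_left inner_add_right inner_commute powr_minus_divide)
        moreover have "\<beta> * \<tau> powr (-3) * (x \<tau> \<bullet> x \<tau>) \<ge> 0"
          using beta_pos by simp
        ultimately show ?thesis by linarith
      qed
      ultimately show "\<exists>d\<le>0. ((\<lambda>t. 1 / 2 * (x' t \<bullet> x' t) + ?c t) has_real_derivative d) (at \<tau> within {s..t})"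
        by blast
    qed
  qed
  then show ?thesis by (simp add: energy_def)
qed

section \<open>The gap to a comparison point and the anchored functional\<close>

definition gap :: "'a \<Rightarrow> real \<Rightarrow> real" where
  "gap z t = Min (range (\<lambda>i. f i (x t) - f i z))"

lemma gap_le: "gap z t \<le> f i (x t) - f i z"
  unfolding gap_def by (intro Min_le) auto

lemma cont_gap: "continuous_on {a..b} (gap z)" if "t0 \<le> a"
  unfolding gap_def[abs_def] by (intro continuous_on_Min_image continuous_intros cont_f that) auto

text \<open>By convexity of each \<open>f i\<close> every gradient lies in the half-space of all
  \<open>c\<close> with the asserted property, and a convex set containing the gradients contains
  their hull.\<close>

lemma gap_le_inner:
  assumes "c \<in> convex hull (range (\<lambda>i. g i (x t)))"
  shows "gap z t \<le> (x t - z) \<bullet> c"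
proof -
  have "convex hull (range (\<lambda>i. g i (x t))) \<subseteq> {c. (x t - z) \<bullet> c \<ge> gap z t}"
  proof (rule hull_minimal)
    show "range (\<lambda>i. g i (x t)) \<subseteq> {c. (x t - z) \<bullet> c \<ge> gap z t}"
    proof safe
      fix i
      have "f i (x t) + g i (x t) \<bullet> (z - x t) \<le> f i z"
        by (rule convex_on_above_gradient[OF conv grad])
      then show "gap z t \<le> (x t - z) \<bullet> g i (x t)"
        using gap_le[of z t i] by (simp add: inner_commute algebra_simps)
    qed
    show "convex {c. (x t - z) \<bullet> c \<ge> gap z t}"
      by (rule convex_halfspace_ge)
  qed
  with assms show ?thesis by blast
qed

text \<open>The coefficient \<open>\<alpha> - q * t powr (q - 1)\<close> is chosen so that the
  multiples of \<open>(x t - z) \<bullet> x' t\<close> coming from \<open>t powr q\<close> and from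
  the damping cancel in the derivative.\<close>

definition anchored :: "'a \<Rightarrow> real \<Rightarrow> real" where
  "anchored z t = t powr q * ((x t - z) \<bullet> x' t) + (\<alpha> - q * t powr (q - 1)) * (1 / 2 * ((x t - z) \<bullet> (x t - z)))"

text \<open>The second half of \<open>projection_inequalities\<close> replaces the acceleration by a
  hull element, whose pairing with \<open>x t - z\<close> is at least the gap. What remains is of
  order \<open>t powr (q - 2)\<close> by boundedness.\<close>

lemma anchored_estimate:
  assumes T: "t0 \<le> T" and z: "norm z \<le> B"
  shows "anchored z T + integral {t0..T} (\<lambda>s. s powr q * gap z s)
    \<le> anchored z t0 + integral {t0..T} (\<lambda>s. s powr q * (x' s \<bullet> x' s))
      + 2 * B\<^sup>2 * (\<beta> + q * (1 - q)) * integral {t0..T} (\<lambda>s. s powr (q - 2))"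
proof -
  \<comment> \<open>Both \<open>- ((x t - z) \<bullet> x t)\<close> and half of the squared distance
    to \<open>z\<close> are at most \<open>2 * B\<^sup>2\<close>; they enter with weights
    \<open>\<beta>\<close> and \<open>q * (1 - q)\<close>.\<close>
  define K where "K = 2 * B\<^sup>2 * (\<beta> + q * (1 - q))"
  \<comment> \<open>Adding the integral of \<open>\<psi>\<close> to the anchored functional turns
    the claim into monotonicity of a single function.\<close>
  define \<psi> where "\<psi> s = s powr q * gap z s - s powr q * (x' s \<bullet> x' s) - K * s powr (q - 2)" for s
  define \<Psi> where "\<Psi> t = integral {t0..t} \<psi>" for t
  have conts: "continuous_on {t0..T} (\<lambda>s. s powr q * gap z s)"
    "continuous_on {t0..T} (\<lambda>s. s powr q * (x' s \<bullet> x' s))"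
    "continuous_on {t0..T} (\<lambda>s. s powr (q - 2))"
    by (intro continuous_intros cont_gap cont_x' order_refl; use t0_pos in simp)+
  have cont\<psi>: "continuous_on {t0..T} \<psi>"
    unfolding \<psi>_def[abs_def] by (intro continuous_on_diff continuous_on_mult_left conts)
  have \<Psi>_deriv: "(\<Psi> has_real_derivative \<psi> t) (at t within {t0..T})" if "t \<in> {t0..T}" for t
    unfolding \<Psi>_def[abs_def] by (rule integral_has_real_derivative[OF cont\<psi> that])
  have z_deriv: "((\<lambda>t. x t - z) has_vector_derivative x' t) (at t within {t0..T})" if "t \<in> {t0..T}" for t
    using x_deriv[OF order_refl that] by (auto intro!: derivative_eq_intros)
  have powr_deriv: "((\<lambda>t. t powr r) has_real_derivative r * t powr (r - 1)) (at t within {t0..T})"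
    if "t \<in> {t0..T}" for t r
    using that t0_pos by (auto intro!: derivative_eq_intros)
  let ?h = "\<lambda>t. 1 / 2 * ((x t - z) \<bullet> (x t - z))"
  let ?c = "\<lambda>t. (\<alpha> - q * t powr (q - 1)) * ?h t + \<Psi> t"
  let ?c' = "\<lambda>t. (\<alpha> - q * t powr (q - 1)) * ((x t - z) \<bullet> x' t) + (- (q * ((q - 1) * t powr (q - 2)))) * ?h t + \<psi> t"
  have c_deriv: "(?c has_real_derivative ?c' t) (at t within {t0..T})" if "t \<in> {t0..T}" for t
  proof -
    have "((\<lambda>t. \<alpha> - q * t powr (q - 1)) has_real_derivative - (q * ((q - 1) * t powr (q - 2)))) (at t within {t0..T})"
      using DERIV_diff[OF DERIV_const DERIV_cmult[OF powr_deriv[OF that, of "q - 1"], of q], of \<alpha>] by simp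
    moreover have "(?h has_real_derivative (x t - z) \<bullet> x' t) (at t within {t0..T})"
      using DERIV_cmult[OF has_real_derivative_inner[OF z_deriv[OF that] z_deriv[OF that]], of "1 / 2"]
      by (simp add: inner_commute)
    ultimately show ?thesis
      by (intro DERIV_add DERIV_mult' \<Psi>_deriv that)
  qed
  have contz: "continuous_on {t0..T} (\<lambda>t. x t - z)"
    by (intro continuous_intros cont_x) auto
  have contq: "continuous_on {t0..T} (\<lambda>t. t powr r)" for r
    by (intro continuous_intros) (use t0_pos in auto)
  have ac1: "abs_continuous_on t0 T (\<lambda>t. x t - z)"
    by (rule C1_imp_abs_continuous_on[OF z_deriv cont_x'[OF order_refl]])
  have ac2: "abs_continuous_on t0 T (\<lambda>t. t powr q)"
    using powr_deriv
    by (intro C1_imp_abs_continuous_on[where y' = "\<lambda>t. q * t powr (q - 1)"] continuous_intros contq)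
      (auto simp: has_real_derivative_iff_has_vector_derivative)
  have ac3: "abs_continuous_on t0 T ?c"
  proof (rule C1_imp_abs_continuous_on)
    show "(?c has_vector_derivative ?c' t) (at t within {t0..T})" if "t \<in> {t0..T}" for t
      using c_deriv[OF that] by (simp only: has_real_derivative_iff_has_vector_derivative)
    show "continuous_on {t0..T} ?c'"
      by (intro continuous_intros contz contq cont_x'[OF order_refl] cont\<psi>)
  qed
  have ac: "abs_continuous_on t0 T (\<lambda>t. t powr q * ((x t - z) \<bullet> x' t) + ?c t)"
    by (intro abs_continuous_on_add[OF _ ac3] abs_continuous_on_mult[OF ac2]
        abs_continuous_on_inner[OF ac1 ac_x'[OF order_refl]] cont_x'[OF order_refl] contz contq continuous_on_inner)
  have "T powr q * ((x T - z) \<bullet> x' T) + ?c T \<le> t0 powr q * ((x t0 - z) \<bullet> x' t0) + ?c t0"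
  proof (rule abs_continuous_on_nonincreasing[OF T ac])
    show "AE t in lborel. t \<in> {t0<..<T} \<longrightarrow>
      (\<exists>d\<le>0. ((\<lambda>t. t powr q * ((x t - z) \<bullet> x' t) + ?c t) has_real_derivative d) (at t within {t0..T}))"
      using AE_accel projection_inequalities
    proof (eventually_elim, intro impI)
      fix t assume t: "t \<in> {t0<..<T}"
        and acc: "t > t0 \<longrightarrow> (x' has_vector_derivative x'' t) (at t)"
        and pr: "t0 \<le> t \<longrightarrow>
         (\<forall>i. (g i (x t) + (\<beta> / t powr 2) *\<^sub>R x t + x'' t + (\<alpha> / t powr q) *\<^sub>R x' t) \<bullet> x' t \<le> 0) \<and>
         - ((\<beta> / t powr 2) *\<^sub>R x t + x'' t + (\<alpha> / t powr q) *\<^sub>R x' t) \<in> convex hull range (\<lambda>i. g i (x t))"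
      have t': "t > t0" "t > 0" "t \<in> {t0..T}" using t t0_pos by auto
      let ?d = "(t powr q * ((x t - z) \<bullet> x'' t + x' t \<bullet> x' t) + q * t powr (q - 1) * ((x t - z) \<bullet> x' t)) + ?c' t"
      have "(x' has_vector_derivative x'' t) (at t within {t0..T})"
        using acc t' by (auto intro: has_vector_derivative_at_within)
      note DERIV_add[OF DERIV_mult'[OF powr_deriv[OF t'(3), of q] has_real_derivative_inner[OF z_deriv[OF t'(3)] this]] c_deriv[OF t'(3)]]
      moreover have "?d \<le> 0"
      proof -
        have "gap z t \<le> (x t - z) \<bullet> (- ((\<beta> / t powr 2) *\<^sub>R x t + x'' t + (\<alpha> / t powr q) *\<^sub>R x' t))"
          using pr t' by (intro gap_le_inner) auto
        also have "\<dots> = - (\<beta> * t powr (-2) * ((x t - z) \<bullet> x t)) - (x t - z) \<bullet> x'' t - \<alpha> * t powr (-q) * ((x t - z) \<bullet> x' t)"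
          by (simp add: inner_add_right inner_diff_right powr_minus_divide)
        finally have "t powr q * gap z t \<le> t powr q * (- (\<beta> * t powr (-2) * ((x t - z) \<bullet> x t)) - (x t - z) \<bullet> x'' t - \<alpha> * t powr (-q) * ((x t - z) \<bullet> x' t))"
          by (intro mult_left_mono) auto
        also have "\<dots> = - (\<beta> * t powr (q - 2) * ((x t - z) \<bullet> x t)) - t powr q * ((x t - z) \<bullet> x'' t) - \<alpha> * ((x t - z) \<bullet> x' t)"
        proof -
          have "t powr q * t powr (-2) = t powr (q - 2)" "t powr q * t powr (-q) = 1"
            using t' by (simp_all add: powr_add[symmetric])
          moreover have "P * (- (\<beta> * R * a) - b - \<alpha> * S * c) = - (\<beta> * (P * R) * a) - P * b - \<alpha> * ((P * S) * c)"
            for P R S a b c :: real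
            by (simp add: algebra_simps)
          ultimately show ?thesis by simp
        qed
        finally have gap: "t powr q * gap z t \<le> \<dots>" .
        have "(norm (x t - z))\<^sup>2 \<le> (2 * B)\<^sup>2"
          using x_bound[of t] z t' norm_triangle_ineq4[of "x t" z] by (intro power_mono) auto
        then have h: "(x t - z) \<bullet> (x t - z) \<le> 4 * B\<^sup>2"
          by (simp add: dot_square_norm)
        have "\<bar>(x t - z) \<bullet> x t\<bar> \<le> norm (x t - z) * norm (x t)"
          by (rule Cauchy_Schwarz_ineq2)
        also have "\<dots> \<le> (2 * B) * B"
          using x_bound[of t] z t' norm_triangle_ineq4[of "x t" z] order_trans[OF norm_ge_zero z]
          by (intro mult_mono) auto
        finally have "- ((x t - z) \<bullet> x t) \<le> 2 * B\<^sup>2"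
          by (simp add: power2_eq_square)
        then have "\<beta> * - ((x t - z) \<bullet> x t) + q * (1 - q) * ?h t \<le> \<beta> * (2 * B\<^sup>2) + q * (1 - q) * (2 * B\<^sup>2)"
          using h beta_pos q_range by (intro add_mono mult_left_mono) auto
        also have "\<dots> = K" by (simp add: K_def algebra_simps)
        finally have bound: "t powr (q - 2) * (\<beta> * - ((x t - z) \<bullet> x t) + q * (1 - q) * ?h t) \<le> t powr (q - 2) * K"
          by (intro mult_left_mono) auto
        \<comment> \<open>The sign of the derivative is now pure real algebra in \<open>gap\<close>
          and \<open>bound\<close>, stated with letters for the powers and inner products.\<close>
        have "(P * (b + n) + q * Q * c) + ((\<alpha> - q * Q) * c + - (q * ((q - 1) * R)) * h + (P * m - P * n - K * R)) \<le> 0"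
          if "P * m \<le> - (\<beta> * R * a) - P * b - \<alpha> * c" "R * (\<beta> * - a + q * (1 - q) * h) \<le> R * K"
          for P Q R a b c h m n :: real
          using that by (simp add: algebra_simps)
        from this[OF gap bound] show ?thesis unfolding \<psi>_def .
      qed
      ultimately show "\<exists>d\<le>0. ((\<lambda>t. t powr q * ((x t - z) \<bullet> x' t) + ?c t) has_real_derivative d) (at t within {t0..T})"
        by blast
    qed
  qed
  moreover have "\<Psi> t0 = 0" by (simp add: \<Psi>_def)
  moreover have "\<Psi> T = integral {t0..T} (\<lambda>s. s powr q * gap z s) - integral {t0..T} (\<lambda>s. s powr q * (x' s \<bullet> x' s))
      - K * integral {t0..T} (\<lambda>s. s powr (q - 2))"
    unfolding \<Psi>_def \<psi>_def[abs_def]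
    by (subst integral_diff integral_mult_right; (intro integrable_continuous_real continuous_intros conts)?)+ auto
  ultimately show ?thesis
    unfolding anchored_def K_def by simp
qed

section \<open>Uniform weighted bounds for the velocity\<close>

lemma integral_powr_le:
  assumes "t0 \<le> T"
  shows "integral {t0..T} (\<lambda>s. s powr (q - 2)) \<le> t0 powr (q - 1) / (1 - q)"
proof -
  have "((\<lambda>s. s powr (q - 2)) has_integral
      T powr (q - 1) / (q - 1) - t0 powr (q - 1) / (q - 1)) {t0..T}"
  proof (rule fundamental_theorem_of_calculus[OF assms])
    fix s assume "s \<in> {t0..T}"
    then have "s > 0" using t0_pos by simp
    then have "((\<lambda>s. s powr (q - 1)) has_real_derivative (q - 1) * s powr (q - 2)) (at s within {t0..T})"
      by (auto intro!: derivative_eq_intros)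
    from DERIV_cdivide[OF this, of "q - 1"]
    show "((\<lambda>s. s powr (q - 1) / (q - 1)) has_vector_derivative s powr (q - 2)) (at s within {t0..T})"
      using q_range by (simp add: has_real_derivative_iff_has_vector_derivative)
  qed
  then have "integral {t0..T} (\<lambda>s. s powr (q - 2)) = t0 powr (q - 1) / (1 - q) - T powr (q - 1) / (1 - q)"
    using q_range by (simp add: integral_unique divide_simps) (simp add: algebra_simps)
  \<comment> \<open>Since \<open>q < 1\<close>, the upper endpoint only lowers the integral, so the
    bound is uniform in \<open>T\<close>.\<close>
  moreover have "T powr (q - 1) / (1 - q) \<ge> 0" using q_range by simp
  ultimately show ?thesis by simp
qed

text \<open>No constant depends on \<open>T\<close>: \<open>C0\<close> bounds \<open>V t0\<close>,
  \<open>K1\<close> bounds \<open>anchored z t0\<close>, and \<open>K2\<close> collects the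
  coefficients of the integral of \<open>s powr (q - 2)\<close>. Any index \<open>i\<close> serves
  in \<open>C0\<close>, because the gap is a minimum.\<close>

lemma weighted_velocity_estimate:
  fixes i :: 'i
  assumes T: "t0 \<le> T"
  defines "C0 \<equiv> 2 * B * norm (g i (x t0)) + \<beta> / 2 * t0 powr (-2) * B\<^sup>2 + 1 / 2 * (x' t0 \<bullet> x' t0)"
    and "K1 \<equiv> t0 powr q * (2 * B * norm (x' t0)) + (\<alpha> + q * t0 powr (q - 1)) * (2 * B\<^sup>2)"
    and "K2 \<equiv> 2 * B\<^sup>2 * (\<beta> + q * (1 - q)) + \<beta> / 2 * B\<^sup>2"
  shows "dissipated T \<le> C0"
    and "\<alpha> * integral {t0..T} (\<lambda>s. s * (x' s \<bullet> x' s)) \<le> t0 powr (1 + q) * C0 +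
      2 * (K1 + K2 * (t0 powr (q - 1) / (1 - q))) + 3 * integral {t0..T} (\<lambda>s. s powr q * (x' s \<bullet> x' s))"
proof -
  \<comment> \<open>With the endpoint as comparison point, \<open>gap z T\<close> and
    \<open>anchored z T\<close> vanish.\<close>
  define z where "z = x T"
  define V where "V t = gap z t + (\<beta> / 2 * t powr (-2) * (x t \<bullet> x t) + 1 / 2 * (x' t \<bullet> x' t)) + dissipated t" for t
  have z: "norm z \<le> B" using x_bound T by (simp add: z_def)
  have B: "B \<ge> 0" using z norm_ge_zero order_trans by blast
  have V_mono: "V t \<le> V s" if "t0 \<le> s" "s \<le> t" for s t
  proof -
    \<comment> \<open>An index attaining the minimum at the earlier time passes the decay of its
      energy on to the minimum at the later time.\<close>
    have "gap z s \<in> range (\<lambda>i. f i (x s) - f i z)"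
      unfolding gap_def by (intro Min_in) auto
    then obtain j where j: "gap z s = f j (x s) - f j z" by blast
    show ?thesis
      using energy_dissipation[OF that, of j] gap_le[of z t j] unfolding V_def j energy_def by linarith
  qed
  have xx: "x t \<bullet> x t \<le> B\<^sup>2" if "t \<ge> t0" for t
    using x_bound[OF that] by (simp add: dot_square_norm power_mono)
  have dist2: "norm (x t - z) \<le> 2 * B" if "t \<ge> t0" for t
    using x_bound[OF that] z norm_triangle_ineq4[of "x t" z] by linarith
  have V0: "V t0 \<le> C0"
  proof -
    have "gap z t0 \<le> f i (x t0) - f i z" by (rule gap_le)
    \<comment> \<open>Convexity trades the value at \<open>z\<close>, which varies with
      \<open>T\<close>, for the gradient at the fixed point \<open>x t0\<close>.\<close>
    also have "\<dots> \<le> g i (x t0) \<bullet> (x t0 - z)"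
      using convex_on_above_gradient[OF conv grad, of i "x t0" z] by (simp add: inner_diff_right)
    also have "\<dots> \<le> norm (g i (x t0)) * norm (x t0 - z)"
      by (rule norm_cauchy_schwarz)
    also have "\<dots> \<le> norm (g i (x t0)) * (2 * B)"
      by (intro mult_left_mono dist2) auto
    finally have "gap z t0 \<le> 2 * B * norm (g i (x t0))" by (simp add: mult_ac)
    moreover have "\<beta> / 2 * t0 powr (-2) * (x t0 \<bullet> x t0) \<le> \<beta> / 2 * t0 powr (-2) * B\<^sup>2"
      using xx[of t0] beta_pos by (intro mult_left_mono) auto
    moreover have "dissipated t0 = 0" by (simp add: dissipated_def)
    ultimately show ?thesis by (simp add: V_def C0_def)
  qed
  have "gap z T = 0" by (simp add: gap_def z_def)
  moreover have "\<beta> / 2 * T powr (-2) * (x T \<bullet> x T) + 1 / 2 * (x' T \<bullet> x' T) \<ge> 0"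
    using beta_pos by simp
  ultimately have AV: "dissipated T \<le> V T" by (simp add: V_def)
  have VT: "V T \<le> C0" using V_mono[OF order_refl T] V0 by simp
  with AV show "dissipated T \<le> C0" by simp

  have contq: "continuous_on {t0..T} (\<lambda>s. s powr r)" for r
    by (intro continuous_intros) (use t0_pos in auto)
  have contv: "continuous_on {t0..T} (\<lambda>s. x' s \<bullet> x' s)"
    by (intro continuous_on_inner cont_x' order_refl)
  define J where "J = integral {t0..T} (\<lambda>s. s * (x' s \<bullet> x' s))"
  define Iq where "Iq = integral {t0..T} (\<lambda>s. s powr q)"
  define IA where "IA = integral {t0..T} (\<lambda>s. s powr q * dissipated s)"
  define I2 where "I2 = integral {t0..T} (\<lambda>s. s powr q * (x' s \<bullet> x' s))"
  define I3 where "I3 = integral {t0..T} (\<lambda>s. s powr (q - 2))"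
  define Im where "Im = integral {t0..T} (\<lambda>s. s powr q * gap z s)"
  have J: "((\<lambda>s. s * (x' s \<bullet> x' s)) has_integral J) {t0..T}"
    unfolding J_def by (intro integrable_integral integrable_continuous_real continuous_on_mult continuous_on_id contv)
  have Iq: "((\<lambda>s. s powr q) has_integral Iq) {t0..T}"
    unfolding Iq_def by (intro integrable_integral integrable_continuous_real contq)
  have IA: "((\<lambda>s. s powr q * dissipated s) has_integral IA) {t0..T}"
    unfolding IA_def by (intro integrable_integral integrable_continuous_real continuous_on_mult contq cont_dissipated order_refl)
  have I2: "((\<lambda>s. s powr q * (x' s \<bullet> x' s)) has_integral I2) {t0..T}"
    unfolding I2_def by (intro integrable_integral integrable_continuous_real continuous_on_mult contq contv)
  have I3: "((\<lambda>s. s powr (q - 2)) has_integral I3) {t0..T}"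
    unfolding I3_def by (intro integrable_integral integrable_continuous_real contq)
  have I23_nonneg: "I2 \<ge> 0" "I3 \<ge> 0"
    by (rule has_integral_nonneg[OF I2], simp) (rule has_integral_nonneg[OF I3], simp)
  have Im: "((\<lambda>s. s powr q * gap z s) has_integral Im) {t0..T}"
    unfolding Im_def by (intro integrable_integral integrable_continuous_real continuous_on_mult contq cont_gap order_refl)
  have powr_deriv: "((\<lambda>t. t powr (1 + q)) has_real_derivative (1 + q) * s powr q) (at s within {t0..T})"
    if "s \<in> {t0..T}" for s
    using that t0_pos by (auto intro!: derivative_eq_intros)
  \<comment> \<open>Integration by parts of \<open>s powr (1 + q)\<close> against the derivative of
    \<open>dissipated\<close>, which vanishes at \<open>t0\<close>.\<close>
  have by_parts: "(1 + q) * IA + \<alpha> * J = T powr (1 + q) * dissipated T"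
  proof -
    have "((\<lambda>s. (1 + q) * (s powr q * dissipated s) + \<alpha> * (s * (x' s \<bullet> x' s))) has_integral
        T powr (1 + q) * dissipated T - t0 powr (1 + q) * dissipated t0) {t0..T}"
    proof (rule fundamental_theorem_of_calculus[OF T])
      fix s assume s: "s \<in> {t0..T}"
      then have "s powr (1 + q) * s powr (-q) = s"
        using t0_pos by (simp add: powr_add[symmetric])
      moreover have "s powr (1 + q) * (\<alpha> * s powr (-q) * (x' s \<bullet> x' s))
          = \<alpha> * ((s powr (1 + q) * s powr (-q)) * (x' s \<bullet> x' s))"
        by (simp only: mult_ac)
      ultimately have eq: "s powr (1 + q) * (\<alpha> * s powr (-q) * (x' s \<bullet> x' s)) = \<alpha> * (s * (x' s \<bullet> x' s))"
        by simp
      show "((\<lambda>s. s powr (1 + q) * dissipated s) has_vector_derivative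
          (1 + q) * (s powr q * dissipated s) + \<alpha> * (s * (x' s \<bullet> x' s))) (at s within {t0..T})"
        using DERIV_mult'[OF powr_deriv[OF s] dissipated_deriv[OF order_refl s], unfolded eq]
        by (simp add: has_real_derivative_iff_has_vector_derivative add.commute mult.assoc)
    qed
    moreover have "((\<lambda>s. (1 + q) * (s powr q * dissipated s) + \<alpha> * (s * (x' s \<bullet> x' s))) has_integral
        (1 + q) * IA + \<alpha> * J) {t0..T}"
      by (intro has_integral_add has_integral_mult_right IA J)
    ultimately show ?thesis
      by (simp add: has_integral_unique dissipated_def[of t0])
  qed
  have "((\<lambda>s. (1 + q) * s powr q) has_integral T powr (1 + q) - t0 powr (1 + q)) {t0..T}"
    by (rule fundamental_theorem_of_calculus[OF T])
      (use powr_deriv in \<open>simp add: has_real_derivative_iff_has_vector_derivative\<close>)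
  then have Iq_eq: "(1 + q) * Iq = T powr (1 + q) - t0 powr (1 + q)"
    using has_integral_mult_right[OF Iq, of "1 + q"] has_integral_unique by blast
  \<comment> \<open>The inequality \<open>V T \<le> V s\<close> is integrated with weight
    \<open>s powr q\<close>, which is the derivative of \<open>s powr (1 + q)\<close> up to the
    factor \<open>1 + q\<close>.\<close>
  have "V T * Iq \<le> Im + \<beta> / 2 * B\<^sup>2 * I3 + 1 / 2 * I2 + IA"
  proof (rule has_integral_le[OF has_integral_mult_right[OF Iq]
        has_integral_add[OF has_integral_add[OF has_integral_add[OF Im has_integral_mult_right[OF I3]]
            has_integral_mult_right[OF I2]] IA]])
    fix s assume s: "s \<in> {t0..T}"
    then have "s powr q * V T \<le> s powr q * V s"
      by (intro mult_left_mono V_mono) auto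
    also have "\<dots> = s powr q * gap z s + s powr q * s powr (-2) * (\<beta> / 2 * (x s \<bullet> x s))
        + 1 / 2 * (s powr q * (x' s \<bullet> x' s)) + s powr q * dissipated s"
      by (simp add: V_def algebra_simps)
    also have "s powr q * s powr (-2) = s powr (q - 2)"
      by (simp add: powr_add[symmetric])
    also have "s powr (q - 2) * (\<beta> / 2 * (x s \<bullet> x s)) \<le> s powr (q - 2) * (\<beta> / 2 * B\<^sup>2)"
      using xx[of s] s beta_pos by (intro mult_left_mono) auto
    finally show "V T * s powr q \<le> s powr q * gap z s + \<beta> / 2 * B\<^sup>2 * s powr (q - 2)
        + 1 / 2 * (s powr q * (x' s \<bullet> x' s)) + s powr q * dissipated s"
      by (simp add: mult_ac)
  qed
  moreover have "Im \<le> K1 + I2 + 2 * B\<^sup>2 * (\<beta> + q * (1 - q)) * I3"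
  proof -
    have "anchored z T = 0" by (simp add: anchored_def z_def)
    moreover have "anchored z t0 \<le> K1"
    proof -
      have "(x t0 - z) \<bullet> x' t0 \<le> norm (x t0 - z) * norm (x' t0)"
        by (rule norm_cauchy_schwarz)
      also have "\<dots> \<le> 2 * B * norm (x' t0)"
        by (intro mult_right_mono dist2) auto
      finally have 1: "t0 powr q * ((x t0 - z) \<bullet> x' t0) \<le> t0 powr q * (2 * B * norm (x' t0))"
        by (intro mult_left_mono) auto
      have "(norm (x t0 - z))\<^sup>2 \<le> (2 * B)\<^sup>2"
        by (intro power_mono dist2) auto
      then have 2: "1 / 2 * ((x t0 - z) \<bullet> (x t0 - z)) \<le> 2 * B\<^sup>2"
        by (simp add: dot_square_norm)
      \<comment> \<open>The sign of the coefficient is unknown, so it is first replaced by a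
        nonnegative majorant.\<close>
      have "(\<alpha> - q * t0 powr (q - 1)) * (1 / 2 * ((x t0 - z) \<bullet> (x t0 - z)))
          \<le> (\<alpha> + q * t0 powr (q - 1)) * (1 / 2 * ((x t0 - z) \<bullet> (x t0 - z)))"
        using q_range by (intro mult_right_mono) auto
      also have "\<dots> \<le> (\<alpha> + q * t0 powr (q - 1)) * (2 * B\<^sup>2)"
        using q_range alpha_pos by (intro mult_left_mono 2) auto
      finally show ?thesis using 1 by (simp add: anchored_def K1_def)
    qed
    ultimately show ?thesis
      using anchored_estimate[OF T z] unfolding Im_def I2_def I3_def by linarith
  qed
  ultimately have "V T * Iq \<le> K1 + 3 / 2 * I2 + K2 * I3 + IA"
    by (simp add: K2_def algebra_simps)
  then have "(1 + q) * (V T * Iq) \<le> (1 + q) * (K1 + 3 / 2 * I2 + K2 * I3 + IA)"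
    using q_range by (intro mult_left_mono) auto
  then have "V T * ((1 + q) * Iq) \<le> (1 + q) * (K1 + 3 / 2 * I2 + K2 * I3) + (1 + q) * IA"
    by (simp add: algebra_simps)
  \<comment> \<open>The integral \<open>IA\<close> cancels between the integration by parts and the
    weighted energy inequality.\<close>
  then have "\<alpha> * J \<le> T powr (1 + q) * dissipated T - V T * (T powr (1 + q) - t0 powr (1 + q))
      + (1 + q) * (K1 + 3 / 2 * I2 + K2 * I3)"
    using by_parts unfolding Iq_eq by linarith
  \<comment> \<open>The growing weight \<open>T powr (1 + q)\<close> multiplies
    \<open>dissipated T - V T\<close>, which is nonpositive, and so drops out.\<close>
  moreover have "T powr (1 + q) * dissipated T \<le> T powr (1 + q) * V T"
    using AV by (intro mult_left_mono) auto
  moreover have "t0 powr (1 + q) * V T \<le> t0 powr (1 + q) * C0"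
    using VT by (intro mult_left_mono) auto
  ultimately have "\<alpha> * J \<le> t0 powr (1 + q) * C0 + (1 + q) * (K1 + 3 / 2 * I2 + K2 * I3)"
    by (simp add: algebra_simps)
  \<comment> \<open>Here \<open>1 + q \<le> 2\<close> turns the coefficient \<open>3 / 2\<close> of
    \<open>I2\<close> into the final \<open>3\<close>.\<close>
  also have "(1 + q) * (K1 + 3 / 2 * I2 + K2 * I3) \<le> 2 * (K1 + 3 / 2 * I2 + K2 * (t0 powr (q - 1) / (1 - q)))"
  proof (intro mult_mono add_mono mult_left_mono order_refl)
    have "K1 \<ge> 0" "K2 \<ge> 0" using B alpha_pos beta_pos q_range by (simp_all add: K1_def K2_def)
    then show "0 \<le> K1 + 3 / 2 * I2 + K2 * I3" "K2 \<ge> 0" "0 \<le> I2" "0 \<le> I3" using I23_nonneg by simp_all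
    show "I3 \<le> t0 powr (q - 1) / (1 - q)" unfolding I3_def by (rule integral_powr_le[OF T])
  qed (use q_range in auto)
  finally show "\<alpha> * integral {t0..T} (\<lambda>s. s * (x' s \<bullet> x' s)) \<le> t0 powr (1 + q) * C0 +
      2 * (K1 + K2 * (t0 powr (q - 1) / (1 - q))) + 3 * integral {t0..T} (\<lambda>s. s powr q * (x' s \<bullet> x' s))"
    by (simp add: J_def I2_def algebra_simps)
qed

text \<open>The threshold \<open>S\<close> is where \<open>s powr (1 - q)\<close> reaches
  \<open>6 / \<alpha>\<close>: beyond it the linear term dominates, and below it
  \<open>s powr (2 * q)\<close> is at most \<open>S powr (2 * q)\<close>.\<close>

lemma powr_interpolation:
  obtains M where "M \<ge> 0" "\<And>s. s > 0 \<Longrightarrow> 3 * s powr q \<le> \<alpha> / 2 * s + M * s powr (-q)"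
proof
  define S where "S = (6 / \<alpha>) powr (1 / (1 - q))"
  have S: "S > 0" "S powr (1 - q) = 6 / \<alpha>"
    using alpha_pos q_range by (simp_all add: S_def powr_powr)
  show "3 * S powr (2 * q) \<ge> 0" by simp
  fix s :: real assume s: "s > 0"
  show "3 * s powr q \<le> \<alpha> / 2 * s + 3 * S powr (2 * q) * s powr (-q)"
  proof (cases "S \<le> s")
    case True
    then have "6 / \<alpha> \<le> s powr (1 - q)"
      using S q_range by (metis diff_ge_0_iff_ge less_imp_le powr_mono2)
    then have "6 / \<alpha> * s powr q \<le> s powr (1 - q) * s powr q"
      by (intro mult_right_mono) auto
    also have "\<dots> = s" using s by (simp add: powr_add[symmetric])
    finally have "3 * s powr q \<le> \<alpha> / 2 * s"
      using alpha_pos by (simp add: field_simps)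
    then show ?thesis by (simp add: add_increasing2)
  next
    case False
    have "s powr q = s powr (2 * q) * s powr (-q)"
      using s by (simp add: powr_add[symmetric])
    also have "\<dots> \<le> S powr (2 * q) * s powr (-q)"
      using False s q_range by (intro mult_right_mono powr_mono2) auto
    finally show ?thesis using alpha_pos s by (simp add: add_increasing)
  qed
qed

text \<open>Interpolation bounds the integral with weight \<open>s powr q\<close> by half of the
  left-hand side plus a multiple of \<open>dissipated T\<close>; the first part is absorbed and the
  second is at most a constant.\<close>

lemma velocity_weighted_integrals_bounded:
  "\<exists>C. \<forall>T\<ge>t0. integral {t0..T} (\<lambda>s. s * (x' s \<bullet> x' s)) \<le> C"
proof -
  obtain M where M: "M \<ge> 0" "\<And>s. s > 0 \<Longrightarrow> 3 * s powr q \<le> \<alpha> / 2 * s + M * s powr (-q)"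
    using powr_interpolation by blast
  obtain C0 C1 where C: "\<And>T. t0 \<le> T \<Longrightarrow> dissipated T \<le> C0"
    "\<And>T. t0 \<le> T \<Longrightarrow> \<alpha> * integral {t0..T} (\<lambda>s. s * (x' s \<bullet> x' s))
      \<le> C1 + 3 * integral {t0..T} (\<lambda>s. s powr q * (x' s \<bullet> x' s))"
    using weighted_velocity_estimate by blast
  show ?thesis
  proof (intro exI allI impI)
    fix T assume T: "t0 \<le> T"
    let ?J = "integral {t0..T} (\<lambda>s. s * (x' s \<bullet> x' s))"
    have contq: "continuous_on {t0..T} (\<lambda>s. s powr r)" for r
      by (intro continuous_intros) (use t0_pos in auto)
    have contv: "continuous_on {t0..T} (\<lambda>s. x' s \<bullet> x' s)"
      by (intro continuous_on_inner cont_x' order_refl)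
    have I2: "((\<lambda>s. s powr q * (x' s \<bullet> x' s)) has_integral integral {t0..T} (\<lambda>s. s powr q * (x' s \<bullet> x' s))) {t0..T}"
      by (intro integrable_integral integrable_continuous_real continuous_on_mult contq contv)
    have J: "((\<lambda>s. s * (x' s \<bullet> x' s)) has_integral ?J) {t0..T}"
      by (intro integrable_integral integrable_continuous_real continuous_on_mult continuous_on_id contv)
    have A: "((\<lambda>s. \<alpha> * s powr (-q) * (x' s \<bullet> x' s)) has_integral dissipated T) {t0..T}"
      unfolding dissipated_def
      by (intro integrable_integral integrable_continuous_real continuous_on_mult continuous_on_const contq contv)
    have "3 * integral {t0..T} (\<lambda>s. s powr q * (x' s \<bullet> x' s)) \<le> \<alpha> / 2 * ?J + M / \<alpha> * dissipated T"
    proof (rule has_integral_le[OF has_integral_mult_right[OF I2]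
          has_integral_add[OF has_integral_mult_right[OF J] has_integral_mult_right[OF A]]])
      fix s assume "s \<in> {t0..T}"
      then have "3 * s powr q * (x' s \<bullet> x' s) \<le> (\<alpha> / 2 * s + M * s powr (-q)) * (x' s \<bullet> x' s)"
        using t0_pos by (intro mult_right_mono M) auto
      then show "3 * (s powr q * (x' s \<bullet> x' s))
          \<le> \<alpha> / 2 * (s * (x' s \<bullet> x' s)) + M / \<alpha> * (\<alpha> * s powr (-q) * (x' s \<bullet> x' s))"
        using alpha_pos by (simp add: algebra_simps)
    qed
    moreover have "M / \<alpha> * dissipated T \<le> M / \<alpha> * C0"
      using C(1)[OF T] M(1) alpha_pos by (intro mult_left_mono) auto
    moreover have "\<alpha> / 2 * ?J = (\<alpha> * ?J) / 2" by simp
    ultimately have "\<alpha> * ?J \<le> 2 * (C1 + M / \<alpha> * C0)"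
      using C(2)[OF T] by argo
    then show "?J \<le> 2 * (C1 + M / \<alpha> * C0) / \<alpha>"
      using alpha_pos by (simp only: pos_le_divide_eq mult.commute)
  qed
qed

end

section \<open>From the weight \<open>s\<close> to all admissible exponents\<close>

theorem mainTheorem17:
  fixes f :: "'i::finite \<Rightarrow> 'a::{real_inner,complete_space} \<Rightarrow> real"
    and g :: "'i \<Rightarrow> 'a \<Rightarrow> 'a"
    and t0 \<alpha> \<beta> q p r :: real
    and x0 v0 :: 'a
    and x x' x'' :: "real \<Rightarrow> 'a"
  assumes conv: "\<And>i. convex_on UNIV (f i)"
    and grad: "\<And>i y. (f i has_derivative (\<lambda>h. g i y \<bullet> h)) (at y)"
    and lip: "\<And>i. \<exists>L. L-lipschitz_on UNIV (g i)"
    and t0_pos: "t0 > 0" and alpha_pos: "\<alpha> > 0" and beta_pos: "\<beta> > 0"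
    and p_eq: "p = 2"
    and q_range: "0 < q" "q < 1"
    and beta_ge: "\<beta> \<ge> q * (1 - q)"
    and A3: "A3 f \<beta> t0 p x0 v0"
    and A4: "A4 f"
    and sol: "MTRIGS_solution g t0 \<alpha> \<beta> q p x0 v0 x x' x''"
    and bdd: "bounded (x ` {t0..})"
    and r_range: "q \<le> r" "r \<le> (1 + q) / 2"
  shows "set_integrable lborel {t0..} (\<lambda>s. s powr (2 * r - q) * (norm (x' s))\<^sup>2)"
proof -
  obtain B where "\<And>t. t \<ge> t0 \<Longrightarrow> norm (x t) \<le> B"
    using bdd unfolding bounded_iff by auto
  moreover have "continuous_on UNIV (g i)" for i
    using lip[of i] lipschitz_on_continuous_on by blast
  ultimately interpret bounded_trajectory f g t0 \<alpha> \<beta> q B x0 v0 x x' x''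
    using conv grad t0_pos alpha_pos beta_pos q_range sol unfolding p_eq
    by unfold_locales
  obtain C where C: "\<And>T. T \<ge> t0 \<Longrightarrow> integral {t0..T} (\<lambda>s. s * (x' s \<bullet> x' s)) \<le> C"
    using velocity_weighted_integrals_bounded by blast
  have cont: "continuous_on {t0..} (\<lambda>s. s powr e * (norm (x' s))\<^sup>2)" for e
    by (intro continuous_intros cont_x'_atLeast) (use t0_pos in auto)
  have int: "set_integrable lborel {t0..} (\<lambda>s. s * (x' s \<bullet> x' s))"
    by (rule set_integrable_atLeast_if_integrals_bounded[OF _ _ C])
      (use t0_pos in \<open>auto intro!: continuous_on_mult continuous_on_id continuous_on_inner cont_x'_atLeast\<close>)
  \<comment> \<open>The bound \<open>r \<le> (1 + q) / 2\<close> makes the exponent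
    \<open>2 * r - q - 1\<close> nonpositive, so its power is largest at \<open>t0\<close> and the
    weight \<open>s\<close> dominates up to the factor \<open>D\<close>.\<close>
  define D where "D = t0 powr (2 * r - q - 1)"
  have "set_integrable lborel {t0..} (\<lambda>s. D * (s * (x' s \<bullet> x' s)))"
    using int by (rule set_integrable_mult_right)
  then show ?thesis
  proof (rule set_integrable_bound)
    show "set_borel_measurable lborel {t0..} (\<lambda>s. s powr (2 * r - q) * (norm (x' s))\<^sup>2)"
      unfolding set_borel_measurable_def measurable_lborel2
      using cont by (intro borel_measurable_continuous_on_indicator) auto
    show "AE s in lborel. s \<in> {t0..} \<longrightarrow>
      norm (s powr (2 * r - q) * (norm (x' s))\<^sup>2) \<le> norm (D * (s * (x' s \<bullet> x' s)))"
    proof (intro AE_I2 impI)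
      fix s assume "s \<in> {t0..}"
      then have s: "t0 \<le> s" "0 < s" using t0_pos by auto
      have "s powr (2 * r - q) = s powr (2 * r - q - 1) * s"
        using s by (simp add: powr_diff)
      also have "\<dots> \<le> D * s"
        unfolding D_def using s t0_pos r_range by (intro mult_right_mono powr_mono2') auto
      finally have "s powr (2 * r - q) * (norm (x' s))\<^sup>2 \<le> D * s * (norm (x' s))\<^sup>2"
        by (intro mult_right_mono) auto
      then show "norm (s powr (2 * r - q) * (norm (x' s))\<^sup>2) \<le> norm (D * (s * (x' s \<bullet> x' s)))"
        using s by (simp add: dot_square_norm abs_mult D_def mult.assoc)
    qed
  qed
qed

end
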